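(* There exist a constant $c>0$ and an infinite sequence of instances $(A,B,u)$, with $A,B\subseteq\mathbb{N}$ finite, $u\in\mathbb{N}$, and $\mathrm{out}:=|(A+B)\cap[u]|$ unbounded along the sequence, such that for every instance in the sequence every rectangle covering of $(A,B,[u])$ has cost at least $c\cdot\mathrm{out}^{1.047}$.
   Context: For an integer $x\ge0$, $[x]=\{0,1,\dots,x\}$. Write $A=\{a_1<\dots<a_n\}$, $B=\{b_1<\dots<b_m\}$ and $A_I=\{a_i:i\in I\}$, $B_J=\{b_j:j\in J\}$. A covering of $(A,B,T)$ is a family $\mathcal{C}$ of pairs $(I,J)$, $I\subseteq\{1..n\}$, $J\subseteq\{1..m\}$, such that every $(i,j)$ with $a_i+b_j\in T$ lies in some $I\times J$ with $(I,J)\in\mathcal{C}$; it is a rectangle covering if all $I,J$ are intervals of consecutive indices; its cost is $\sum_{(I,J)\in\mathcal{C}}|A_I+B_J|$. *)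

theory Defs
  imports Complex_Main
begin

definition elt :: "nat set \<Rightarrow> nat \<Rightarrow> nat" where
  "elt A i = sorted_list_of_set A ! (i - 1)"

definition sub :: "nat set \<Rightarrow> nat set \<Rightarrow> nat set" where
  "sub A I = elt A ` I"

definition sumset :: "nat set \<Rightarrow> nat set \<Rightarrow> nat set" where
  "sumset X Y = {x + y | x y. x \<in> X \<and> y \<in> Y}"

definition is_covering :: "nat set \<Rightarrow> nat set \<Rightarrow> nat set \<Rightarrow> (nat set \<times> nat set) set \<Rightarrow> bool" where
  "is_covering A B T C \<longleftrightarrow>
     finite C \<and>
     (\<forall>(I, J) \<in> C. I \<subseteq> {1..card A} \<and> J \<subseteq> {1..card B}) \<and>
     (\<forall>i \<in> {1..card A}. \<forall>j \<in> {1..card B}. elt A i + elt B j \<in> T \<longrightarrow>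
        (\<exists>(I, J) \<in> C. i \<in> I \<and> j \<in> J))"

definition is_index_interval :: "nat set \<Rightarrow> bool" where
  "is_index_interval I \<longleftrightarrow> (\<exists>l r. I = {l..r})"

definition is_rect_covering :: "nat set \<Rightarrow> nat set \<Rightarrow> nat set \<Rightarrow> (nat set \<times> nat set) set \<Rightarrow> bool" where
  "is_rect_covering A B T C \<longleftrightarrow> is_covering A B T C \<and>
     (\<forall>(I, J) \<in> C. is_index_interval I \<and> is_index_interval J)"

definition covering_cost :: "nat set \<Rightarrow> nat set \<Rightarrow> (nat set \<times> nat set) set \<Rightarrow> nat" where
  "covering_cost A B C = (\<Sum>(I, J) \<in> C. card (sumset (sub A I) (sub B J)))"

definition out_size :: "nat set \<Rightarrow> nat set \<Rightarrow> nat \<Rightarrow> nat" where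
  "out_size A B u = card (sumset A B \<inter> {0..u})"

end

theory Submission
  imports Defs
begin

text \<open>
  Take many pairs $X_i, Y_i$ such that all $X_i + Y_i$ are the same set $F$ while the mixed sumsets
  $X_i + Y_j$ ($i < j$) are small in total. Place far-away translates of the $X_i$ in increasing and of
  the $Y_i$ in decreasing order, so that the translates of all $X_i + Y_i$ coincide, just below $u$. The
  output then has size $O(|F|)$, although the staircase has $n$ corners of cost $|F|$ each. To prevent
  a cheap rectangle from serving several corners at once, insert between consecutive corners a
  second copy of $X_i$ and of $Y_i$. The sum of these two copies lies beyond $u$, in a translate of $F$ that is
  different for every $i$; so a rectangle meeting $t$ corners costs at least $(t-1)|F|$, and every
  covering costs at least $n|F|/2$.

  The pairs come from binary words of length $k$: a letter selects, in one digit, either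
  $\{0,\dots,4\}$ for $X$ and $5\cdot\{0,\dots,4\}$ for $Y$ or the other way round. A matching digit
  contributes a factor $25$ to the size of the sumset, a mismatch only $9$. Greedily chosen words
  have an average factor of at most $17$ per digit, which leaves room for $n = 2^{k/4}$ words, and
  $25^{4 \cdot 1.047} \<le> 2 \cdot 25^4$.
\<close>

section \<open>Index intervals and sumsets\<close>

lemma elt_strict_mono:
  assumes "finite A" "1 \<le> i" "i < j" "j \<le> card A"
  shows "elt A i < elt A j"
  unfolding elt_def using assms sorted_wrt_nth_less[OF strict_sorted_list_of_set[of A], of "i - 1" "j - 1"]
  by simp

lemma elt_surj:
  assumes "finite A" "a \<in> A"
  obtains i where "i \<in> {1..card A}" "elt A i = a"
proof -
  have "a \<in> set (sorted_list_of_set A)" using assms by simp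
  then obtain m where "m < card A" "sorted_list_of_set A ! m = a"
    unfolding in_set_conv_nth by auto
  \<comment> \<open>\<open>elt\<close> counts from 1, list positions from 0.\<close>
  then show ?thesis using that[of "Suc m"] by (simp add: elt_def)
qed

lemma elt_le_iff:
  assumes "finite A" "i \<in> {1..card A}" "j \<in> {1..card A}"
  shows "elt A i \<le> elt A j \<longleftrightarrow> i \<le> j"
  using elt_strict_mono[OF assms(1), of i j] elt_strict_mono[OF assms(1), of j i] assms(2,3)
  by (metis atLeastAtMost_iff leD less_imp_le linorder_neqE_nat order_refl)

text \<open>The cost bound uses the interval shape of the index sets only through this convexity.
  Since \<open>elt\<close> is increasing, an element of \<open>A\<close> between two selected values
  has its index between theirs.\<close>

lemma sub_interval_convex:
  assumes "finite A" "I \<subseteq> {1..card A}" "is_index_interval I"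
    and "x \<in> sub A I" "y \<in> sub A I" "z \<in> A" "x \<le> z" "z \<le> y"
  shows "z \<in> sub A I"
proof -
  obtain i where i: "i \<in> I" "x = elt A i" using assms by (auto simp: sub_def)
  obtain j where j: "j \<in> I" "y = elt A j" using assms by (auto simp: sub_def)
  obtain m where m: "m \<in> {1..card A}" "elt A m = z" using elt_surj assms by metis
  have "i \<le> m" "m \<le> j"
    using elt_le_iff[OF assms(1)] i j m assms by blast+
  then have "m \<in> I" using assms(3) i j by (auto simp: is_index_interval_def)
  then show ?thesis using m by (auto simp: sub_def)
qed

lemma finite_sub: "I \<subseteq> {1..card A} \<Longrightarrow> finite (sub A I)"
  unfolding sub_def using finite_subset by blast

lemma finite_sumset: "finite X \<Longrightarrow> finite Y \<Longrightarrow> finite (sumset X Y)"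
proof -
  have "sumset X Y = (\<lambda>(x, y). x + y) ` (X \<times> Y)" by (auto simp: sumset_def)
  then show "finite X \<Longrightarrow> finite Y \<Longrightarrow> finite (sumset X Y)" by simp
qed

lemma sumset_mono: "X \<subseteq> X' \<Longrightarrow> Y \<subseteq> Y' \<Longrightarrow> sumset X Y \<subseteq> sumset X' Y'"
  by (auto simp: sumset_def)

lemma sumsetI: "x \<in> X \<Longrightarrow> y \<in> Y \<Longrightarrow> x + y \<in> sumset X Y"
  by (auto simp: sumset_def)

lemma sumset_translate:
  "sumset ((+) p ` X) ((+) q ` Y) = (+) (p + q) ` sumset X (Y :: nat set)"
proof (intro equalityI subsetI)
  fix z assume "z \<in> sumset ((+) p ` X) ((+) q ` Y)"
  then obtain x y where "x \<in> X" "y \<in> Y" "z = (p + x) + (q + y)" by (auto simp: sumset_def)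
  then show "z \<in> (+) (p + q) ` sumset X Y"
    by (intro image_eqI[of _ _ "x + y"]) (auto simp: sumset_def)
next
  fix z assume "z \<in> (+) (p + q) ` sumset X Y"
  then obtain x y where "x \<in> X" "y \<in> Y" "z = (p + x) + (q + y)" by (auto simp: sumset_def)
  then show "z \<in> sumset ((+) p ` X) ((+) q ` Y)"
    by (auto simp: sumset_def)
qed

section \<open>Matched families of sets\<close>

text \<open>\<open>M\<close> is a unit of length: it exceeds all elements and all sums, so these
  sets, translated by \<open>M * p\<close>, stay within the unit that starts at
  \<open>M * p\<close>. The conditions are imposed at every index, not only below
  \<open>n\<close>.\<close>

locale matched_family =
  fixes n M :: nat and X Y :: "nat \<Rightarrow> nat set" and F :: "nat set"
  assumes Mpos: "M > 0"
    and finX: "finite (X i)" and finY: "finite (Y i)"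
    and matched: "sumset (X i) (Y i) = F"
    and Xlt: "x \<in> X i \<Longrightarrow> x < M" and Ylt: "y \<in> Y i \<Longrightarrow> y < M"
    and sumlt: "x \<in> X i \<Longrightarrow> y \<in> Y j \<Longrightarrow> x + y < M"
begin

text \<open>
  In units of \<open>M\<close>, both corner blocks of index \<open>i\<close> sum to position \<open>L * n\<close>. The inner sum of a corner
  and a spoiler, at \<open>L * n - 1\<close>, does not depend on \<open>i\<close> either, but the sum of the two spoilers, at
  \<open>L * n + i + 1\<close>, does.
\<close>

definition L :: nat where "L = n + 3"
definition corner_pos :: "nat \<Rightarrow> nat" where "corner_pos i = L * i"
definition spoiler_pos :: "nat \<Rightarrow> nat" where "spoiler_pos i = L * i + i + 2"
definition corner_pos' :: "nat \<Rightarrow> nat" where "corner_pos' i = L * (n - i)"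
definition spoiler_pos' :: "nat \<Rightarrow> nat" where "spoiler_pos' i = L * (n - i) - 1"

definition block :: "nat \<Rightarrow> nat set \<Rightarrow> nat set" where "block p Z = (+) (M * p) ` Z"

definition setA :: "nat set" where
  "setA = (\<Union>i<n. block (corner_pos i) (X i) \<union> block (spoiler_pos i) (X i))"
definition setB :: "nat set" where
  "setB = (\<Union>i<n. block (corner_pos' i) (Y i) \<union> block (spoiler_pos' i) (Y i))"
text \<open>The last number of the unit at position \<open>L * n\<close>: the matched corner sums
  stay within it, and every block at a higher position exceeds it.\<close>

definition bound :: nat where "bound = M * (L * n) + (M - 1)"

lemma finite_block: "finite Z \<Longrightarrow> finite (block p Z)"
  by (simp add: block_def)

lemma card_block: "card (block p Z) = card Z"
  by (simp add: block_def card_image)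

lemma sumset_block: "sumset (block p Z) (block q W) = block (p + q) (sumset Z W)"
  unfolding block_def sumset_translate by (simp add: distrib_left)

lemma finite_setA: "finite setA" and finite_setB: "finite setB"
  by (auto simp: setA_def setB_def finX finY finite_block)

lemma finite_F: "finite F"
  using finite_sumset[OF finX finY] matched by metis

lemma F_lt: "z \<in> F \<Longrightarrow> z < M"
  using matched[of 0] sumlt by (auto simp: sumset_def)

lemma block_less:
  assumes "x \<in> block p Z" "y \<in> block q W" "p < q" "\<And>z. z \<in> Z \<Longrightarrow> z < M"
  shows "x < y"
proof -
  obtain z w where zw: "x = M * p + z" "y = M * q + w" "z < M"
    using assms by (auto simp: block_def)
  have "M * p + M \<le> M * q" using assms(3) mult_le_mono2[of "Suc p" q M] by simp
  then show ?thesis using zw by linarith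
qed

lemma pos_mono: "i < j \<Longrightarrow> L * i + L \<le> L * j"
  using mult_le_mono2[of "Suc i" j L] by simp

lemma pos_sums:
  assumes "i < n"
  shows "corner_pos i + corner_pos' i = L * n"
    "corner_pos i + spoiler_pos' i = L * n - 1"
    "spoiler_pos i + spoiler_pos' i = L * n + i + 1"
    "spoiler_pos i + corner_pos' i = L * n + i + 2"
proof -
  have "L * i + L * (n - i) = L * n" using assms by (simp flip: distrib_left)
  \<comment> \<open>This is where \<open>i < n\<close> matters: the subtraction in
    \<open>spoiler_pos'\<close> is not truncated.\<close>
  moreover have "L * (n - i) \<ge> 1" using assms by (simp add: L_def)
  ultimately show "corner_pos i + corner_pos' i = L * n"
    "corner_pos i + spoiler_pos' i = L * n - 1"
    "spoiler_pos i + spoiler_pos' i = L * n + i + 1"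
    "spoiler_pos i + corner_pos' i = L * n + i + 2"
    unfolding corner_pos_def corner_pos'_def spoiler_pos_def spoiler_pos'_def by linarith+
qed

text \<open>The corner \<open>j\<close> of \<open>setA\<close> has sums at \<open>L * n - 1\<close>
  or above with both blocks of index \<open>j\<close> in \<open>setB\<close>, and a block of larger
  index \<open>i\<close> lies at least \<open>L\<close> further on. So pairs with
  \<open>j < i\<close> never reach the output, and only mixed sumsets with \<open>i < j\<close> have
  to be small.\<close>

lemma pos_sum_gt:
  assumes "j < i" "i < n" "p \<in> {corner_pos i, spoiler_pos i}" "q \<in> {corner_pos' j, spoiler_pos' j}"
  shows "p + q > L * n"
proof -
  have "corner_pos i \<ge> corner_pos j + L" using pos_mono[OF assms(1)] by (simp add: corner_pos_def)
  moreover have "corner_pos i \<le> spoiler_pos i" by (simp add: corner_pos_def spoiler_pos_def)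
  ultimately show ?thesis
    using pos_sums(1,2)[of j] assms by (auto simp: L_def)
qed

lemma block_le_boundD:
  assumes "z \<in> block p W" "z \<le> bound"
  shows "p \<le> L * n"
proof (rule ccontr)
  assume "\<not> p \<le> L * n"
  then have "M * (L * n) + M \<le> M * p" using mult_le_mono2[of "Suc (L * n)" p M] by simp
  moreover have "M * p \<le> z" using assms by (auto simp: block_def)
  ultimately show False using assms(2) unfolding bound_def
    using Mpos by linarith
qed


section \<open>Size of the output\<close>

text \<open>Output sums come from index pairs with \<open>i \<le> j\<close>. All diagonal pairs
  share two translates of \<open>F\<close>; a pair with \<open>i < j\<close> contributes at most
  four translates of its mixed sumset, one for each choice of corner or spoiler on the two
  sides.\<close>

lemma out_size_le:
  assumes "(\<Sum>j<n. \<Sum>i<j. card (sumset (X i) (Y j))) \<le> D"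
  shows "out_size setA setB bound \<le> 2 * card F + 4 * D"
proof -
  let ?W = "\<lambda>j i. block (corner_pos i + corner_pos' j) (sumset (X i) (Y j))
     \<union> block (corner_pos i + spoiler_pos' j) (sumset (X i) (Y j))
     \<union> block (spoiler_pos i + corner_pos' j) (sumset (X i) (Y j))
     \<union> block (spoiler_pos i + spoiler_pos' j) (sumset (X i) (Y j))"
  let ?V = "block (L * n) F \<union> block (L * n - 1) F \<union> (\<Union>j<n. \<Union>i<j. ?W j i)"
  have "sumset setA setB \<inter> {0..bound} \<subseteq> ?V"
  proof
    fix z assume "z \<in> sumset setA setB \<inter> {0..bound}"
    then obtain a b where ab: "a \<in> setA" "b \<in> setB" "z = a + b" "z \<le> bound"
      by (auto simp: sumset_def)
    obtain i p where i: "i < n" "p \<in> {corner_pos i, spoiler_pos i}" "a \<in> block p (X i)"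
      using ab(1) by (auto simp: setA_def)
    obtain j q where j: "j < n" "q \<in> {corner_pos' j, spoiler_pos' j}" "b \<in> block q (Y j)"
      using ab(2) by (auto simp: setB_def)
    have z: "z \<in> block (p + q) (sumset (X i) (Y j))"
      using sumsetI[OF i(3) j(3)] ab(3) by (simp add: sumset_block)
    have le: "p + q \<le> L * n" using block_le_boundD[OF z ab(4)] .
    consider "i < j" | "i = j" | "j < i" by linarith
    then show "z \<in> ?V"
    proof cases
      case 1
      have "z \<in> ?W j i" using z i(2) j(2) by auto
      then show ?thesis using 1 j(1) by blast
    next
      case 2
      \<comment> \<open>The two sums that use the spoiler of \<open>setA\<close> lie beyond
        \<open>L * n\<close>; the other two positions are the same for all \<open>i\<close>.\<close>
      then have "p + q = L * n \<or> p + q = L * n - 1"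
        using le i(2) j(2) pos_sums[OF i(1)] by auto
      then show ?thesis using z 2 matched by auto
    next
      case 3
      then show ?thesis using pos_sum_gt[OF 3 i(1,2) j(2)] le by simp
    qed
  qed
  moreover have fin: "finite (?W j i)" for i j
    by (simp add: finite_block finite_sumset finX finY)
  then have finV: "finite ?V" by (simp add: finite_block finite_F)
  ultimately have "out_size setA setB bound \<le> card ?V"
    unfolding out_size_def by (intro card_mono)
  also have "\<dots> \<le> card (block (L * n) F) + card (block (L * n - 1) F) + card (\<Union>j<n. \<Union>i<j. ?W j i)"
    using card_Un_le[of "block (L * n) F \<union> block (L * n - 1) F"] card_Un_le[of "block (L * n) F"]
    by (meson add_le_mono1 le_trans)
  also have "\<dots> = 2 * card F + card (\<Union>j<n. \<Union>i<j. ?W j i)"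
    by (simp add: card_block)
  also have "card (\<Union>j<n. \<Union>i<j. ?W j i) \<le> (\<Sum>j<n. card (\<Union>i<j. ?W j i))"
    by (rule card_UN_le) simp
  also have "\<dots> \<le> (\<Sum>j<n. \<Sum>i<j. card (?W j i))"
    by (intro sum_mono card_UN_le) simp
  also have "\<dots> \<le> (\<Sum>j<n. \<Sum>i<j. 4 * card (sumset (X i) (Y j)))"
  proof (intro sum_mono)
    fix i j
    have "card (A \<union> B \<union> C \<union> E) \<le> card A + card B + card C + card E" for A B C E :: "nat set"
      by (meson add_le_mono1 card_Un_le le_trans)
    from this[of "block (corner_pos i + corner_pos' j) (sumset (X i) (Y j))"
     "block (corner_pos i + spoiler_pos' j) (sumset (X i) (Y j))"
     "block (spoiler_pos i + corner_pos' j) (sumset (X i) (Y j))"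
     "block (spoiler_pos i + spoiler_pos' j) (sumset (X i) (Y j))"]
    show "card (?W j i) \<le> 4 * card (sumset (X i) (Y j))"
      by (simp add: card_block)
  qed
  also have "\<dots> = 4 * (\<Sum>j<n. \<Sum>i<j. card (sumset (X i) (Y j)))"
    by (simp add: sum_distrib_left)
  also have "\<dots> \<le> 4 * D" using assms by simp
  finally show ?thesis by simp
qed

lemma corner_sum_le_bound:
  assumes "i < n" "a \<in> block (corner_pos i) (X i)" "b \<in> block (corner_pos' i) (Y i)"
  shows "a + b \<le> bound"
proof -
  have "a + b \<in> block (L * n) F"
    using sumsetI[OF assms(2,3)] by (simp add: sumset_block pos_sums assms(1) matched)
  then show ?thesis using F_lt by (fastforce simp: block_def bound_def)
qed

text \<open>The corner of index 0 alone produces a full translate of \<open>F\<close>. This makes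
  the output unbounded along the sequence of instances.\<close>

lemma out_size_ge:
  assumes "n > 0"
  shows "card F \<le> out_size setA setB bound"
proof -
  have "block (L * n) F \<subseteq> sumset setA setB \<inter> {0..bound}"
  proof
    fix z assume "z \<in> block (L * n) F"
    then have "z \<in> sumset (block (corner_pos 0) (X 0)) (block (corner_pos' 0) (Y 0))"
      by (simp add: sumset_block pos_sums assms matched)
    then obtain a b where "a \<in> block (corner_pos 0) (X 0)" "b \<in> block (corner_pos' 0) (Y 0)" "z = a + b"
      by (auto simp: sumset_def)
    then show "z \<in> sumset setA setB \<inter> {0..bound}"
      using assms corner_sum_le_bound[of 0 a b] by (auto simp: setA_def setB_def intro!: sumsetI)
  qed
  then have "card (block (L * n) F) \<le> out_size setA setB bound"
    unfolding out_size_def by (intro card_mono) auto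
  then show ?thesis by (simp add: card_block)
qed

section \<open>Cost of rectangle coverings\<close>

text \<open>The corners of the staircase that a rectangle with value sets \<open>P\<close> and
  \<open>Q\<close> can help to cover.\<close>

definition corners_met :: "nat set \<Rightarrow> nat set \<Rightarrow> nat set" where
  "corners_met P Q = {i \<in> {..<n}. P \<inter> block (corner_pos i) (X i) \<noteq> {} \<and> Q \<inter> block (corner_pos' i) (Y i) \<noteq> {}}"

text \<open>Let \<open>lo\<close> and \<open>hi\<close> be the extreme corners met. By convexity
  \<open>P\<close> and \<open>Q\<close> contain all spoilers of index
  \<open>lo \<le> i < hi\<close>, whose sums are disjoint translates of \<open>F\<close>.\<close>

lemma spoiler_sumset_le:
  assumes conv: "\<And>x y z. x \<in> P \<Longrightarrow> y \<in> P \<Longrightarrow> z \<in> setA \<Longrightarrow> x \<le> z \<Longrightarrow> z \<le> y \<Longrightarrow> z \<in> P"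
    and conv': "\<And>x y z. x \<in> Q \<Longrightarrow> y \<in> Q \<Longrightarrow> z \<in> setB \<Longrightarrow> x \<le> z \<Longrightarrow> z \<le> y \<Longrightarrow> z \<in> Q"
    and fin: "finite P" "finite Q" and two: "card (corners_met P Q) \<ge> 2"
  shows "card (corners_met P Q) * card F \<le> 2 * card (sumset P Q)"
proof -
  let ?T = "corners_met P Q"
  have finT: "finite ?T" by (simp add: corners_met_def)
  have neT: "?T \<noteq> {}" using two by auto
  define lo hi where "lo = Min ?T" and "hi = Max ?T"
  have lo: "lo \<in> ?T" and hi: "hi \<in> ?T" using finT neT by (simp_all add: lo_def hi_def)
  have "?T \<subseteq> {lo..hi}" using finT by (auto simp: lo_def hi_def)
  then have cardT: "card ?T \<le> Suc hi - lo" using card_mono[of "{lo..hi}" ?T] by simp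
  have hin: "hi < n" using hi by (simp add: corners_met_def)
  obtain a1 b1 where lo': "a1 \<in> P" "a1 \<in> block (corner_pos lo) (X lo)"
      "b1 \<in> Q" "b1 \<in> block (corner_pos' lo) (Y lo)"
    using lo by (auto simp: corners_met_def)
  obtain a2 b2 where hi': "a2 \<in> P" "a2 \<in> block (corner_pos hi) (X hi)"
      "b2 \<in> Q" "b2 \<in> block (corner_pos' hi) (Y hi)"
    using hi by (auto simp: corners_met_def)
  \<comment> \<open>On both sides the spoiler \<open>i\<close> lies next to the corner
    \<open>i\<close>, towards the corner \<open>i + 1\<close>: above it in \<open>setA\<close>,
    below it in \<open>setB\<close>, whose order is reversed. Hence \<open>lo\<close> is included
    and \<open>hi\<close> is not.\<close>
  have sub: "block (L * n + i + 1) F \<subseteq> sumset P Q" if i: "lo \<le> i" "i < hi" for i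
  proof -
    have "block (spoiler_pos i) (X i) \<subseteq> P"
    proof
      fix z assume z: "z \<in> block (spoiler_pos i) (X i)"
      have "corner_pos lo < spoiler_pos i"
        using mult_le_mono2[OF i(1), of L] unfolding corner_pos_def spoiler_pos_def by linarith
      \<comment> \<open>The stride \<open>L = n + 3\<close> exceeds the spoiler offset
        \<open>i + 2\<close>.\<close>
      moreover have "spoiler_pos i < corner_pos hi"
        using pos_mono[OF i(2)] hin i by (simp add: corner_pos_def spoiler_pos_def L_def)
      ultimately have "a1 < z" "z < a2" using block_less lo'(2) hi'(2) z Xlt by blast+
      moreover have "z \<in> setA" using z i hin by (auto simp: setA_def)
      ultimately show "z \<in> P" using conv lo' hi' by (meson less_imp_le)
    qed
    moreover have "block (spoiler_pos' i) (Y i) \<subseteq> Q"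
    proof
      fix z assume z: "z \<in> block (spoiler_pos' i) (Y i)"
      have "L * (n - hi) + L \<le> L * (n - i)" using i hin by (intro pos_mono) auto
      then have "corner_pos' hi < spoiler_pos' i"
        by (simp add: corner_pos'_def spoiler_pos'_def L_def)
      moreover have "spoiler_pos' i < corner_pos' lo"
      proof -
        have "L * (n - i) \<le> L * (n - lo)" using i by (intro mult_le_mono2) auto
        moreover have "L * (n - i) > 0" using i hin by (simp add: L_def)
        ultimately show ?thesis unfolding corner_pos'_def spoiler_pos'_def by linarith
      qed
      ultimately have "b2 < z" "z < b1" using block_less lo'(4) hi'(4) z Ylt by blast+
      moreover have "z \<in> setB" using z i hin by (auto simp: setB_def)
      ultimately show "z \<in> Q" using conv' lo' hi' by (meson less_imp_le)
    qed
    ultimately have "sumset (block (spoiler_pos i) (X i)) (block (spoiler_pos' i) (Y i)) \<subseteq> sumset P Q"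
      by (rule sumset_mono)
    then show ?thesis using i hin by (simp add: sumset_block pos_sums matched)
  qed
  have "(hi - lo) * card F = (\<Sum>i\<in>{lo..<hi}. card (block (L * n + i + 1) F))"
    by (simp add: card_block)
  also have "\<dots> = card (\<Union>i\<in>{lo..<hi}. block (L * n + i + 1) F)"
  proof (rule card_UN_disjoint[symmetric])
    show "\<forall>i\<in>{lo..<hi}. \<forall>j\<in>{lo..<hi}. i \<noteq> j \<longrightarrow>
        block (L * n + i + 1) F \<inter> block (L * n + j + 1) F = {}"
    proof (intro ballI impI)
      fix i j :: nat assume "i \<noteq> j"
      then consider "L * n + i + 1 < L * n + j + 1" | "L * n + j + 1 < L * n + i + 1" by linarith
      then show "block (L * n + i + 1) F \<inter> block (L * n + j + 1) F = {}"
        by cases (use block_less F_lt in blast)+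
    qed
  qed (simp_all add: finite_block finite_F)
  also have "\<dots> \<le> card (sumset P Q)"
    using sub by (intro card_mono finite_sumset fin UN_least) auto
  finally have "(hi - lo) * card F \<le> card (sumset P Q)" .
  \<comment> \<open>There are at most \<open>hi - lo + 1\<close> corners, and two distinct ones
    force \<open>hi - lo \<ge> 1\<close>; the factor 2 absorbs the extra corner.\<close>
  moreover have "card ?T \<le> 2 * (hi - lo)" using cardT two by linarith
  then have "card ?T * card F \<le> 2 * (hi - lo) * card F" by (rule mult_le_mono1)
  ultimately show ?thesis by linarith
qed

text \<open>Double counting: every rectangle pays an amount \<open>h c\<close> to each corner it
  meets. Each corner receives at least \<open>card F\<close>, while no rectangle pays more than
  twice its own cost.\<close>

lemma rect_covering_cost_ge:
  assumes "is_rect_covering setA setB {0..bound} C"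
  shows "n * card F \<le> 2 * covering_cost setA setB C"
proof -
  have finC: "finite C" using assms by (simp add: is_rect_covering_def is_covering_def)
  define P where "P c = sub setA (fst c)" for c :: "nat set \<times> nat set"
  define Q where "Q c = sub setB (snd c)" for c :: "nat set \<times> nat set"
  have idx: "fst c \<subseteq> {1..card setA}" "snd c \<subseteq> {1..card setB}"
      "is_index_interval (fst c)" "is_index_interval (snd c)" if "c \<in> C" for c
    using assms that unfolding is_rect_covering_def is_covering_def split_beta by blast+
  have fin: "finite (P c)" "finite (Q c)" if "c \<in> C" for c
    using idx[OF that] by (simp_all add: P_def Q_def finite_sub)
  have cost: "covering_cost setA setB C = (\<Sum>c\<in>C. card (sumset (P c) (Q c)))"
    by (simp add: covering_cost_def P_def Q_def split_beta)
  have cover: "\<exists>c\<in>C. a \<in> P c \<and> b \<in> Q c" if ab: "a \<in> setA" "b \<in> setB" "a + b \<le> bound" for a b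
  proof -
    obtain i where i: "i \<in> {1..card setA}" "elt setA i = a" using elt_surj[OF finite_setA ab(1)] .
    obtain j where j: "j \<in> {1..card setB}" "elt setB j = b" using elt_surj[OF finite_setB ab(2)] .
    have "\<exists>(I, J)\<in>C. i \<in> I \<and> j \<in> J"
      using assms i j ab(3) unfolding is_rect_covering_def is_covering_def by auto
    then show ?thesis using i j by (force simp: P_def Q_def sub_def)
  qed
  define T where "T c = corners_met (P c) (Q c)" for c
  \<comment> \<open>A rectangle meeting several corners can afford a full \<open>card F\<close> for
    each, by \<open>spoiler_sumset_le\<close>; one meeting a single corner pays its own
    cost.\<close>
  define h where "h c = (if card (T c) \<ge> 2 then card F else card (sumset (P c) (Q c)))" for c
  have each: "card F \<le> (\<Sum>c\<in>{c\<in>C. i \<in> T c}. h c)" if i: "i < n" for i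
  proof (cases "\<exists>c\<in>C. i \<in> T c \<and> card (T c) \<ge> 2")
    case True
    then obtain c where "c \<in> {c\<in>C. i \<in> T c}" "h c = card F" by (auto simp: h_def)
    then show ?thesis using member_le_sum[of c "{c\<in>C. i \<in> T c}" h] finC by simp
  next
    case False
    \<comment> \<open>Here every rectangle at corner \<open>i\<close> meets no other corner and pays
      its whole sumset; together these sumsets must contain the translate of \<open>F\<close>
      produced by the corner.\<close>
    have "block (L * n) F \<subseteq> (\<Union>c\<in>{c\<in>C. i \<in> T c}. sumset (P c) (Q c))"
    proof
      fix z assume "z \<in> block (L * n) F"
      then have "z \<in> sumset (block (corner_pos i) (X i)) (block (corner_pos' i) (Y i))"
        by (simp add: sumset_block pos_sums i matched)
      then obtain a b where ab: "a \<in> block (corner_pos i) (X i)" "b \<in> block (corner_pos' i) (Y i)" "z = a + b"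
        by (auto simp: sumset_def)
      have "a \<in> setA" "b \<in> setB" using ab i by (auto simp: setA_def setB_def)
      then obtain c where c: "c \<in> C" "a \<in> P c" "b \<in> Q c"
        using cover corner_sum_le_bound[OF i ab(1,2)] by blast
      then have "i \<in> T c" using ab i by (auto simp: T_def corners_met_def)
      then show "z \<in> (\<Union>c\<in>{c\<in>C. i \<in> T c}. sumset (P c) (Q c))"
        using c ab(3) sumsetI by blast
    qed
    then have "card (block (L * n) F) \<le> card (\<Union>c\<in>{c\<in>C. i \<in> T c}. sumset (P c) (Q c))"
      by (intro card_mono) (use finC fin in \<open>auto intro: finite_sumset\<close>)
    also have "\<dots> \<le> (\<Sum>c\<in>{c\<in>C. i \<in> T c}. card (sumset (P c) (Q c)))"
      using finC by (intro card_UN_le) simp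
    also have "\<dots> = (\<Sum>c\<in>{c\<in>C. i \<in> T c}. h c)"
      using False by (intro sum.cong) (auto simp: h_def)
    finally show ?thesis by (simp add: card_block)
  qed
  have "n * card F = (\<Sum>i<n. card F)" by simp
  also have "\<dots> \<le> (\<Sum>i<n. \<Sum>c\<in>{c\<in>C. i \<in> T c}. h c)"
    using each by (intro sum_mono) simp
  also have "\<dots> = (\<Sum>c\<in>C. \<Sum>i\<in>{i\<in>{..<n}. i \<in> T c}. h c)"
    using finC by (intro sum.swap_restrict) auto
  also have "\<dots> = (\<Sum>c\<in>C. card (T c) * h c)"
  proof (rule sum.cong)
    fix c
    have "{i\<in>{..<n}. i \<in> T c} = T c" by (auto simp: T_def corners_met_def)
    then show "(\<Sum>i\<in>{i\<in>{..<n}. i \<in> T c}. h c) = card (T c) * h c" by simp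
  qed simp
  also have "\<dots> \<le> (\<Sum>c\<in>C. 2 * card (sumset (P c) (Q c)))"
  proof (rule sum_mono)
    fix c assume c: "c \<in> C"
    show "card (T c) * h c \<le> 2 * card (sumset (P c) (Q c))"
    proof (cases "card (T c) \<ge> 2")
      case True
      have "card (T c) * card F \<le> 2 * card (sumset (P c) (Q c))"
        unfolding T_def
      proof (rule spoiler_sumset_le)
        show "z \<in> P c" if "x \<in> P c" "y \<in> P c" "z \<in> setA" "x \<le> z" "z \<le> y" for x y z
          using sub_interval_convex[OF finite_setA idx(1,3)[OF c]] that unfolding P_def by blast
        show "z \<in> Q c" if "x \<in> Q c" "y \<in> Q c" "z \<in> setB" "x \<le> z" "z \<le> y" for x y z
          using sub_interval_convex[OF finite_setB idx(2,4)[OF c]] that unfolding Q_def by blast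
      qed (use fin[OF c] True in \<open>auto simp: T_def\<close>)
      then show ?thesis using True by (simp add: h_def)
    next
      case False
      then have "card (T c) \<le> 2" by simp
      then show ?thesis using False mult_le_mono1[of "card (T c)" 2 "h c"] by (simp add: h_def)
    qed
  qed
  also have "\<dots> = 2 * covering_cost setA setB C"
    by (simp add: cost sum_distrib_left)
  finally show ?thesis .
qed

end

section \<open>Digit sets indexed by binary words\<close>

text \<open>Base 41, since the digits of a sum are at most 40: no carries occur.\<close>

definition prepend :: "nat set \<Rightarrow> nat set \<Rightarrow> nat set" where
  "prepend D Z = (\<lambda>(d, x). d + 41 * x) ` (D \<times> Z)"

lemma card_prepend:
  assumes "D \<subseteq> {..<41}"
  shows "card (prepend D Z) = card D * card Z"
proof -
  have "inj_on (\<lambda>(d, x). d + 41 * x) (D \<times> Z)"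
  proof (rule inj_onI, clarify)
    fix d x d' x' :: nat
    assume "d \<in> D" "d' \<in> D" and eq: "d + 41 * x = d' + 41 * x'"
    then have "d < 41" "d' < 41" using assms by auto
    with eq have "x = x'" by linarith
    with eq show "d = d' \<and> x = x'" by simp
  qed
  then show ?thesis by (simp add: prepend_def card_image card_cartesian_product)
qed

lemma prepend_less:
  assumes "D \<subseteq> {..<41}" "Z \<subseteq> {..<N}"
  shows "prepend D Z \<subseteq> {..<41 * N}"
proof
  fix z assume "z \<in> prepend D Z"
  then obtain d x where "d \<in> D" "x \<in> Z" "z = d + 41 * x" by (auto simp: prepend_def)
  moreover from this have "d < 41" "x < N" using assms by auto
  ultimately show "z \<in> {..<41 * N}" by simp
qed

lemma sumset_prepend:
  "sumset (prepend D Z) (prepend D' Z') = prepend (sumset D D') (sumset Z Z')"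
proof (intro equalityI subsetI)
  fix z assume "z \<in> sumset (prepend D Z) (prepend D' Z')"
  then obtain d d' x x' where "d \<in> D" "d' \<in> D'" "x \<in> Z" "x' \<in> Z'" "z = (d + 41 * x) + (d' + 41 * x')"
    by (auto simp: sumset_def prepend_def)
  then show "z \<in> prepend (sumset D D') (sumset Z Z')"
    unfolding prepend_def by (intro image_eqI[of _ _ "(d + d', x + x')"]) (auto intro: sumsetI)
next
  fix z assume "z \<in> prepend (sumset D D') (sumset Z Z')"
  then obtain d d' x x' where *: "d \<in> D" "d' \<in> D'" "x \<in> Z" "x' \<in> Z'" "z = (d + d') + 41 * (x + x')"
    by (auto simp: sumset_def prepend_def)
  have "d + 41 * x \<in> prepend D Z" "d' + 41 * x' \<in> prepend D' Z'"
    using * by (force simp: prepend_def)+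
  from sumsetI[OF this] show "z \<in> sumset (prepend D Z) (prepend D' Z')"
    using * by (simp add: algebra_simps)
qed

definition digits :: "bool \<Rightarrow> nat set" where
  "digits b = (if b then {0, 1, 2, 3, 4} else {0, 5, 10, 15, 20})"

lemma sumset_UN: "sumset X Y = (\<Union>x\<in>X. (+) x ` Y)"
  by (auto simp: sumset_def)

lemma sumset_commute: "sumset X Y = sumset Y X"
  by (force simp: sumset_def add.commute)

lemma card_sumset_digits:
  "card (sumset (digits True) (digits False)) = 25"
  "card (sumset (digits True) (digits True)) = 9"
  "card (sumset (digits False) (digits False)) = 9"
proof -
  show "card (sumset (digits True) (digits True)) = 9"
    by (simp add: sumset_UN digits_def numeral_eq_Suc insert_commute)
qed (simp_all add: sumset_UN digits_def insert_commute)

lemma sumset_digits_Not: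
  "sumset (digits b) (digits (\<not> b)) = sumset (digits True) (digits False)"
  by (cases b) (simp_all add: sumset_commute)

lemma sumset_digits_less: "sumset (digits b) (digits b') \<subseteq> {..<41}"
  by (auto simp: sumset_def digits_def split: if_splits)

lemma digits_less: "digits b \<subseteq> {..<41}"
  by (auto simp: digits_def)

text \<open>The pair belonging to a word \<open>w\<close> is \<open>word_set w\<close> and
  \<open>word_set (map Not w)\<close>.\<close>

fun word_set :: "bool list \<Rightarrow> nat set" where
  "word_set [] = {0}"
| "word_set (b # w) = prepend (digits b) (word_set w)"

text \<open>The common sumset \<open>F\<close>: the numbers with \<open>k\<close> digits in base 41,
  all of them at most 24.\<close>

fun full_set :: "nat \<Rightarrow> nat set" where
  "full_set 0 = {0}"
| "full_set (Suc k) = prepend (sumset (digits True) (digits False)) (full_set k)"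

lemma card_full_set: "card (full_set k) = 25 ^ k"
  by (induction k) (simp_all add: card_prepend sumset_digits_less card_sumset_digits)

lemma finite_word_set: "finite (word_set w)"
  by (induction w) (auto simp: prepend_def digits_def)

lemma word_set_less: "word_set w \<subseteq> {..<41 ^ length w}"
  by (induction w) (simp_all add: prepend_less digits_less)

lemma sumset_zero: "sumset {0} {0} = {0}"
  by (auto simp: sumset_def)

lemma sumset_word_set_less:
  "length v = length w \<Longrightarrow> sumset (word_set w) (word_set v) \<subseteq> {..<41 ^ length w}"
  by (induction v w rule: list_induct2)
    (simp_all add: sumset_zero sumset_prepend prepend_less sumset_digits_less)

lemma sumset_word_set_Not: "sumset (word_set w) (word_set (map Not w)) = full_set (length w)"
  by (induction w) (simp_all add: sumset_zero sumset_prepend sumset_digits_Not)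

section \<open>Overlaps of words and greedy choice\<close>

abbreviation overlap :: "bool list \<Rightarrow> bool list \<Rightarrow> nat" where
  "overlap w v \<equiv> card (sumset (word_set w) (word_set (map Not v)))"

text \<open>Negating the second word turns agreeing letters into unlike digit sets, with 25 sums,
  and differing letters into equal ones, with 9. Sizes multiply because no carries occur.\<close>

lemma overlap_Cons: "overlap (b # w) (c # v) = (if b = c then 25 else 9) * overlap w v"
  by (cases b; cases c)
    (simp_all add: sumset_prepend card_prepend sumset_digits_less card_sumset_digits
      sumset_commute[of "digits False" "digits True"])

lemma words_Suc:
  "{v :: bool list. length v = Suc k} = (#) True ` {v. length v = k} \<union> (#) False ` {v. length v = k}"
proof -
  have "v \<in> (#) True ` {v. length v = k} \<union> (#) False ` {v. length v = k}" if "length v = Suc k" for v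
    using that by (cases v; cases "hd v") auto
  then show ?thesis by auto
qed

lemma finite_words: "finite {v :: bool list. length v = k}"
  using finite_lists_length_eq[of "UNIV :: bool set" k] by simp

lemma card_words: "card {v :: bool list. length v = k} = 2 ^ k"
  using card_lists_length_eq[of "UNIV :: bool set" k] by simp

text \<open>The sum over all words factorises over the letters, each giving
  \<open>25 + 9 = 34\<close>.\<close>

lemma sum_overlap: "(\<Sum>v\<in>{v. length v = length w}. overlap w v) = 34 ^ length w"
proof (induction w)
  case Nil
  then show ?case by (simp add: sumset_zero)
next
  case (Cons b w)
  have "(\<Sum>v\<in>{v. length v = length (b # w)}. overlap (b # w) v)
      = (\<Sum>v\<in>(#) True ` {v. length v = length w}. overlap (b # w) v)
      + (\<Sum>v\<in>(#) False ` {v. length v = length w}. overlap (b # w) v)"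
    unfolding length_Cons words_Suc by (intro sum.union_disjoint) (auto simp: finite_words)
  also have "\<dots> = (\<Sum>v\<in>{v. length v = length w}. overlap (b # w) (True # v))
      + (\<Sum>v\<in>{v. length v = length w}. overlap (b # w) (False # v))"
    by (subst (1 2) sum.reindex) (auto simp: inj_on_def)
  also have "\<dots> = 34 * (\<Sum>v\<in>{v. length v = length w}. overlap w v)"
    unfolding overlap_Cons sum_distrib_left[symmetric] by (cases b) simp_all
  finally show ?case using Cons.IH by simp
qed

text \<open>Averaging: over the \<open>2 ^ k\<close> words \<open>v\<close>, the mean of the total
  overlap is \<open>n * (34 / 2) ^ k\<close>.\<close>

lemma exists_word_small_overlap:
  assumes "\<And>i. length (f i) = k"
  shows "\<exists>v. length v = k \<and> (\<Sum>i<n::nat. overlap (f i) v) \<le> n * 17 ^ k"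
proof (rule ccontr)
  assume "\<not> ?thesis"
  then have *: "n * 17 ^ k < (\<Sum>i<n. overlap (f i) v)" if "length v = k" for v
    using that by (metis not_le)
  have "2 ^ k * (n * 17 ^ k) = (\<Sum>v\<in>{v :: bool list. length v = k}. n * 17 ^ k)"
    by (simp add: card_words)
  also have "\<dots> < (\<Sum>v\<in>{v. length v = k}. \<Sum>i<n. overlap (f i) v)"
  proof (rule sum_strict_mono)
    show "{v :: bool list. length v = k} \<noteq> {}" using assms[of 0] by blast
  qed (use * finite_words in auto)
  also have "\<dots> = (\<Sum>i<n. \<Sum>v\<in>{v. length v = k}. overlap (f i) v)"
    by (rule sum.swap)
  also have "\<dots> = n * 34 ^ k"
    using sum_overlap[of "f i" for i] assms by simp
  also have "\<dots> = 2 ^ k * (n * 17 ^ k)"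
    by (simp flip: power_mult_distrib)
  finally show False by simp
qed

lemma exists_code:
  "\<exists>f. (\<forall>i. length (f i) = k) \<and> (\<forall>j<n. (\<Sum>i<j. overlap (f i) (f j)) \<le> j * 17 ^ k)"
proof (induction n)
  case 0
  \<comment> \<open>Any word of length \<open>k\<close> serves as default; \<open>f\<close> is total
    because \<open>matched_family\<close> constrains all indices.\<close>
  show ?case by (rule exI[of _ "\<lambda>_. replicate k True"]) simp
next
  case (Suc n)
  then obtain f where f: "\<And>i. length (f i) = k" "\<And>j. j < n \<Longrightarrow> (\<Sum>i<j. overlap (f i) (f j)) \<le> j * 17 ^ k"
    by auto
  obtain v where v: "length v = k" "(\<Sum>i<n. overlap (f i) v) \<le> n * 17 ^ k"
    using exists_word_small_overlap[of f k n] f(1) by blast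
  define g where "g = f(n := v)"
  have "(\<Sum>i<j. overlap (g i) (g j)) \<le> j * 17 ^ k" if "j < Suc n" for j
  proof -
    have "(\<Sum>i<j. overlap (g i) (g j)) = (\<Sum>i<j. overlap (f i) (g j))"
      using that by (intro sum.cong) (auto simp: g_def)
    then show ?thesis using f(2)[of j] v(2) that by (cases "j = n") (auto simp: g_def)
  qed
  moreover have "length (g i) = k" for i using f(1) v(1) by (simp add: g_def)
  ultimately show ?case by blast
qed

section \<open>Instances and the exponent\<close>

text \<open>Here \<open>390625 = 25 ^ 4\<close> and \<open>781250 = 2 * 25 ^ 4\<close>, so the two
  powers are \<open>card F\<close> and \<open>n * card F\<close>.\<close>

lemma exists_instance:
  "\<exists>A B u. finite A \<and> finite B \<and> out_size A B u \<ge> 390625 ^ m \<and> out_size A B u \<le> 6 * 390625 ^ m \<and>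
     (\<forall>C. is_rect_covering A B {0..u} C \<longrightarrow> 781250 ^ m \<le> 2 * covering_cost A B C)"
proof -
  \<comment> \<open>The mixed sumsets total at most \<open>n\<^sup>2 * 17 ^ k\<close>. The ratio 4
    is the least integer \<open>e\<close> with \<open>4 * 17 ^ e \<le> 25 ^ e\<close>, which keeps
    this total below \<open>card F\<close>.\<close>
  define k n :: nat where "k = 4 * m" and "n = 2 ^ m"
  obtain f where f: "\<And>i. length (f i) = k" "\<And>j. j < n \<Longrightarrow> (\<Sum>i<j. overlap (f i) (f j)) \<le> j * 17 ^ k"
    using exists_code[of k n] by auto
  interpret matched_family n "41 ^ k" "\<lambda>i. word_set (f i)" "\<lambda>i. word_set (map Not (f i))" "full_set k"
  proof
    show "x + y < 41 ^ k" if "x \<in> word_set (f i)" "y \<in> word_set (map Not (f j))" for x y i j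
      using sumset_word_set_less[of "map Not (f j)" "f i"] sumsetI[OF that] f(1) by auto
    show "x < 41 ^ k" if "x \<in> word_set (f i)" for x i
      using word_set_less[of "f i"] that f(1) by auto
    show "x < 41 ^ k" if "x \<in> word_set (map Not (f i))" for x i
      using word_set_less[of "map Not (f i)"] that f(1) by auto
  qed (simp_all add: finite_word_set sumset_word_set_Not f(1))
  have S: "card (full_set k) = 390625 ^ m"
    unfolding card_full_set k_def power_mult by simp
  have "(\<Sum>j<n. \<Sum>i<j. overlap (f i) (f j)) \<le> (\<Sum>j<n. n * 17 ^ k)"
    by (rule sum_mono) (use f(2) in \<open>fastforce intro: order_trans\<close>)
  also have "\<dots> = (2 * 2 * 17 ^ 4) ^ m"
    by (simp add: n_def k_def power_mult flip: power_mult_distrib)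
  also have "\<dots> \<le> 390625 ^ m" by (rule power_mono) simp_all
  finally have "out_size setA setB bound \<le> 6 * 390625 ^ m"
    using out_size_le S by fastforce
  moreover have "390625 ^ m \<le> out_size setA setB bound"
    using out_size_ge S by (simp add: n_def)
  moreover have "781250 ^ m \<le> 2 * covering_cost setA setB C" if "is_rect_covering setA setB {0..bound} C" for C
    using rect_covering_cost_ge[OF that] by (simp add: S n_def flip: power_mult_distrib)
  ultimately show ?thesis using finite_setA finite_setB by blast
qed

text \<open>After division by 390625 the claim is \<open>390625 powr 0.047 \<le> 2\<close>; the
  1000th power makes it the integer comparison \<open>390625 ^ 47 \<le> 2 ^ 1000\<close>.\<close>

lemma powr_exponent_bound: "(390625::real) powr 1.047 \<le> 781250"
proof -
  define x :: real where "x = 390625 powr 0.047"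
  have "x ^ 1000 = x powr real 1000"
    by (rule powr_realpow[symmetric]) (simp add: x_def)
  also have "\<dots> = 390625 powr real 47"
    unfolding x_def powr_powr by (rule arg_cong[where f = "\<lambda>e. 390625 powr e"]) simp
  also have "\<dots> = 390625 ^ 47" by (rule powr_realpow) simp
  also have "\<dots> \<le> 2 ^ 1000" by simp
  finally have "x \<le> 2"
    using power_mono_iff[of x 2 1000] by (simp only: x_def powr_ge_zero zero_le_numeral zero_less_numeral)
  moreover have "(390625::real) powr 1.047 = 390625 * x"
    using powr_add[of "390625::real" 1 "0.047"] by (simp add: x_def)
  ultimately show ?thesis by simp
qed

theorem mainTheorem5:
  shows "\<exists>c::real. c > 0 \<and>
    (\<exists>(A :: nat \<Rightarrow> nat set) (B :: nat \<Rightarrow> nat set) (u :: nat \<Rightarrow> nat).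
       (\<forall>k. finite (A k) \<and> finite (B k)) \<and>
       (\<forall>N. \<exists>k. out_size (A k) (B k) (u k) \<ge> N) \<and>
       (\<forall>k C. is_rect_covering (A k) (B k) {0..u k} C \<longrightarrow>
          real (covering_cost (A k) (B k) C) \<ge> c * real (out_size (A k) (B k) (u k)) powr 1.047))"
proof -
  \<comment> \<open>The 2 is the loss in the covering bound; \<open>6 powr 1.047\<close> comes from
    the output being up to 6 times \<open>card F\<close>.\<close>
  define c :: real where "c = 1 / (2 * 6 powr 1.047)"
  obtain A B u where inst: "\<And>m. finite (A m)" "\<And>m. finite (B m)"
      "\<And>m. out_size (A m) (B m) (u m) \<ge> 390625 ^ m"
      "\<And>m. out_size (A m) (B m) (u m) \<le> 6 * 390625 ^ m"
      "\<And>m C. is_rect_covering (A m) (B m) {0..u m} C \<Longrightarrow> 781250 ^ m \<le> 2 * covering_cost (A m) (B m) C"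
    using exists_instance by metis
  have "\<exists>m. out_size (A m) (B m) (u m) \<ge> N" for N
  proof
    have "N \<le> 390625 ^ N" by (simp add: less_imp_le)
    then show "N \<le> out_size (A N) (B N) (u N)" using inst(3)[of N] by linarith
  qed
  moreover have "c * real (out_size (A m) (B m) (u m)) powr 1.047 \<le> real (covering_cost (A m) (B m) C)"
    if "is_rect_covering (A m) (B m) {0..u m} C" for m C
  proof -
    have "real (out_size (A m) (B m) (u m)) \<le> 6 * 390625 ^ m"
      using of_nat_mono[OF inst(4)[of m], where 'a = real] by simp
    then have "real (out_size (A m) (B m) (u m)) powr 1.047 \<le> (6 * 390625 ^ m) powr 1.047"
      by (intro powr_mono2) auto
    also have "\<dots> = 6 powr 1.047 * (390625 powr 1.047) ^ m"
    proof -
      have "((390625::real) ^ m) powr 1.047 = (390625 powr real m) powr 1.047"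
        by (subst powr_realpow) simp_all
      also have "\<dots> = (390625 powr 1.047) powr real m"
        by (simp only: powr_powr mult.commute)
      also have "\<dots> = (390625 powr 1.047) ^ m"
        by (rule powr_realpow) simp
      finally show ?thesis by (simp add: powr_mult)
    qed
    also have "\<dots> \<le> 6 powr 1.047 * 781250 ^ m"
      using powr_exponent_bound by (intro mult_left_mono power_mono) auto
    finally have "c * real (out_size (A m) (B m) (u m)) powr 1.047 \<le> 781250 ^ m / 2"
      by (simp add: c_def field_simps)
    also have "\<dots> \<le> real (covering_cost (A m) (B m) C)"
      using of_nat_mono[OF inst(5)[OF that], where 'a = real] by simp
    finally show ?thesis .
  qed
  ultimately show ?thesis using inst(1,2)
    by (intro exI[of _ c] conjI exI[of _ A] exI[of _ B] exI[of _ u]) (auto simp: c_def)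
qed

end
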